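(* Let $n$ be a positive odd integer and let $p$ be a prime such that $p>n+1$. (i) If $\{a_k\}_{k\ge 0}\in\mathcal{S}_{-}$ is a sequence of rational numbers such that $a_0,\dots,a_{p-1}$ are $p$-integral, then $$\sum_{0<k_1<\cdots<k_{n}<p}\frac{a_{p-k_n}}{k_1\cdots k_{n}}\equiv \sum_{0<k_1<\cdots<k_{n}<p}\frac{a_{k_1}}{k_1\cdots k_{n}}\equiv 0 \pmod{p}.$$ (ii) If $\{a_k\}_{k\ge 0}\in\mathcal{S}_{+}$ is a sequence of rational numbers such that $a_0,\dots,a_{p-2}$ are $p$-integral, then $$\sum_{0<k_1<\cdots<k_{n}<p}\frac{a_{p-k_n-1}}{k_1\cdots k_{n-1}}\equiv \sum_{0<k_1<\cdots<k_{n}<p}\frac{a_{k_1-1}}{k_2\cdots k_{n}}\equiv 0 \pmod{p}.$$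
   Context: $\mathcal{S}_{+}$ (respectively $\mathcal{S}_{-}$) denotes the set of sequences $\{a_k\}_{k\ge 0}$ satisfying $\sum_{k=0}^{r}\binom{r}{k}(-1)^k a_k=a_r$ (respectively $=-a_r$) for all integers $r\ge 0$, i.e. the eigenspaces for the eigenvalues $1$ and $-1$ of the binomial transform. The sums run over integers $k_1<\cdots<k_n$ in the indicated range; for $n=1$ the empty products $k_1\cdots k_{n-1}$ and $k_2\cdots k_n$ equal $1$. A rational number is $p$-integral if its denominator is not divisible by $p$. For $p$-integral rationals $x,y$, $x\equiv y\pmod p$ means that $(x-y)/p$ is $p$-integral. *)

theory Defs
  imports Complex_Main "HOL-Library.FuncSet" "HOL-Computational_Algebra.Primes"
begin

definition binomial_transform :: "(nat \<Rightarrow> 'a::comm_ring_1) \<Rightarrow> nat \<Rightarrow> 'a" where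
  "binomial_transform a r = (\<Sum>k=0..r. of_nat (r choose k) * (-1) ^ k * a k)"

definition S_plus :: "(nat \<Rightarrow> 'a::comm_ring_1) set" where
  "S_plus = {a. \<forall>r. binomial_transform a r = a r}"

definition S_minus :: "(nat \<Rightarrow> 'a::comm_ring_1) set" where
  "S_minus = {a. \<forall>r. binomial_transform a r = - a r}"

text \<open>The second component of \<open>quotient_of x\<close> is the positive denominator of \<open>x\<close> in lowest terms.\<close>

definition p_integral :: "nat \<Rightarrow> rat \<Rightarrow> bool" where
  "p_integral p x \<longleftrightarrow> \<not> int p dvd snd (quotient_of x)"

text \<open>Congruence is meaningful for \<open>p\<close>-integral rationals only, so it is taken to include
  \<open>p\<close>-integrality of both sides.\<close>

definition rat_cong :: "nat \<Rightarrow> rat \<Rightarrow> rat \<Rightarrow> bool" where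
  "rat_cong p x y \<longleftrightarrow>
     p_integral p x \<and> p_integral p y \<and> p_integral p ((x - y) / of_nat p)"

text \<open>The tuples \<open>0 < k 1 < \<dots> < k n < p\<close>. Extensionality (\<open>k i = undefined\<close> outside \<open>{1..n}\<close>)
  makes each tuple correspond to exactly one function.\<close>

definition incr_tuples :: "nat \<Rightarrow> nat \<Rightarrow> (nat \<Rightarrow> nat) set" where
  "incr_tuples n p = {k \<in> {1..n} \<rightarrow>\<^sub>E {0<..<p}. strict_mono_on {1..n} k}"

end

theory Submission
  imports Defs "HOL-Computational_Algebra.Polynomial" "HOL-Computational_Algebra.Formal_Power_Series"
begin

text \<open>Write \<open>g N\<close> for the polynomial \<open>(x + c + N - 1) gchoose N\<close> in \<open>x\<close>. Since
  \<open>g (m - 1) = (1 + x/1) \<dots> (1 + x/(m - 1))\<close> for \<open>c = 1\<close>, the sums ending in \<open>k n\<close> are the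
  coefficients of \<open>x ^ d\<close> in \<open>\<Sum>k\<le>M. a k * g (M - k)\<close>, where \<open>(c, M, d)\<close> is \<open>(0, p, n)\<close> in the
  first part and \<open>(1, p - 2, n - 1)\<close> in the second. Insert \<open>a k = \<plusminus> \<Sum>j. (k choose j) (-1)^j a j\<close> and
  exchange the sums. By Vandermonde the coefficient of \<open>a j\<close> becomes, up to sign,
  \<open>(x + c + M) gchoose (M - j)\<close>; modulo \<open>p = M + 2 c\<close> this is \<open>(x - c) gchoose (M - j)\<close>, which is
  \<open>g (M - j)\<close> at \<open>- x\<close> up to sign. The signs are such that the sum is congruent to its own
  negative, hence to \<open>0\<close>. The substitution \<open>k i \<mapsto> p - k (n + 1 - i)\<close> turns the sums involving
  \<open>k 1\<close> into those involving \<open>k n\<close>, up to sign modulo \<open>p\<close>.\<close>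

section \<open>Rationals integral at a prime\<close>

text \<open>Any fraction representing \<open>x\<close> may serve as a witness, not only the reduced
  one: by coprimality the reduced denominator divides every other denominator. The closure
  properties below rest on this form.\<close>

lemma p_integral_iff:
  "p_integral p x \<longleftrightarrow> (\<exists>a b. \<not> int p dvd b \<and> x * of_int b = of_int a)"
proof
  assume h: "p_integral p x"
  obtain a b where ab: "quotient_of x = (a, b)" by force
  have "x = of_int a / of_int b" "b > 0"
    using ab quotient_of_div quotient_of_denom_pos by blast+
  then have "x * of_int b = of_int a" by simp
  with h ab show "\<exists>a b. \<not> int p dvd b \<and> x * of_int b = of_int a"
    unfolding p_integral_def by auto
next
  assume "\<exists>a b. \<not> int p dvd b \<and> x * of_int b = of_int a"
  then obtain a b where h: "\<not> int p dvd b" "x * of_int b = of_int a" by blast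
  obtain c d where cd: "quotient_of x = (c, d)" by force
  have x: "x = of_int c / of_int d" "d > 0" "coprime c d"
    using cd quotient_of_div quotient_of_denom_pos quotient_of_coprime by blast+
  have "(of_int (c * b) :: rat) = of_int (a * d)"
    using h(2) x(1,2) by (simp add: field_simps)
  then have "c * b = a * d" by (simp only: of_int_eq_iff)
  then have "d dvd c * b" by simp
  with x(3) have "d dvd b" by (simp add: coprime_commute coprime_dvd_mult_right_iff)
  with h(1) show "p_integral p x"
    unfolding p_integral_def cd by (auto intro: dvd_trans)
qed

lemma p_integral_of_int: "prime p \<Longrightarrow> p_integral p (of_int z)"
  unfolding p_integral_iff by (intro exI[of _ z] exI[of _ 1]) (auto simp: zdvd1_eq)

lemma p_integral_0: "prime p \<Longrightarrow> p_integral p 0"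
  using p_integral_of_int[of p 0] by simp

lemma p_integral_1: "prime p \<Longrightarrow> p_integral p 1"
  using p_integral_of_int[of p 1] by simp

lemma p_integral_mult:
  assumes "prime p" "p_integral p x" "p_integral p y"
  shows "p_integral p (x * y)"
proof -
  from assms obtain a b c d where h: "\<not> int p dvd b" "x * of_int b = of_int a"
    "\<not> int p dvd d" "y * of_int d = of_int c"
    unfolding p_integral_iff by blast
  have "(x * y) * of_int (b * d) = (x * of_int b) * (y * of_int d)"
    by (simp add: mult_ac)
  also have "\<dots> = of_int (a * c)"
    unfolding h(2,4) by simp
  finally show ?thesis
    using assms(1) h unfolding p_integral_iff
    by (intro exI[of _ "a * c"] exI[of _ "b * d"]) (auto simp: prime_dvd_mult_iff)
qed

lemma p_integral_add:
  assumes "prime p" "p_integral p x" "p_integral p y"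
  shows "p_integral p (x + y)"
proof -
  from assms obtain a b c d where h: "\<not> int p dvd b" "x * of_int b = of_int a"
    "\<not> int p dvd d" "y * of_int d = of_int c"
    unfolding p_integral_iff by blast
  have "(x + y) * of_int (b * d) = (x * of_int b) * of_int d + (y * of_int d) * of_int b"
    by (simp add: algebra_simps)
  also have "\<dots> = of_int (a * d + c * b)"
    unfolding h(2,4) by simp
  finally show ?thesis
    using assms(1) h unfolding p_integral_iff
    by (intro exI[of _ "a * d + c * b"] exI[of _ "b * d"]) (auto simp: prime_dvd_mult_iff)
qed

lemma p_integral_uminus: "prime p \<Longrightarrow> p_integral p x \<Longrightarrow> p_integral p (- x)"
  using p_integral_mult[of p "-1" x] p_integral_of_int[of p "-1"] by simp

lemma p_integral_diff:
  "prime p \<Longrightarrow> p_integral p x \<Longrightarrow> p_integral p y \<Longrightarrow> p_integral p (x - y)"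
  using p_integral_add[of p x "- y"] p_integral_uminus[of p y] by simp

lemma p_integral_sum:
  "prime p \<Longrightarrow> (\<And>i. i \<in> A \<Longrightarrow> p_integral p (f i)) \<Longrightarrow> p_integral p (sum f A)"
  by (induction A rule: infinite_finite_induct) (auto simp: p_integral_0 p_integral_add)

lemma p_integral_prod:
  "prime p \<Longrightarrow> (\<And>i. i \<in> A \<Longrightarrow> p_integral p (f i)) \<Longrightarrow> p_integral p (prod f A)"
  by (induction A rule: infinite_finite_induct) (auto simp: p_integral_1 p_integral_mult)

lemma p_integral_inverse_of_nat:
  assumes "\<not> p dvd m"
  shows "p_integral p (1 / of_nat m)"
proof -
  have "m \<noteq> 0" using assms by (intro notI) simp
  with assms show ?thesis unfolding p_integral_iff
    by (intro exI[of _ 1] exI[of _ "int m"]) auto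
qed

lemma p_integral_if_divisible:
  assumes "prime p" "p_integral p (x / of_nat p)"
  shows "p_integral p x"
proof -
  have "x = of_int (int p) * (x / of_nat p)"
    using assms(1) by (simp add: prime_gt_0_nat)
  then show ?thesis
    using assms p_integral_mult p_integral_of_int by metis
qed

text \<open>Factors are exchanged one at a time: with \<open>F\<close> and \<open>G\<close> the
  remaining products, \<open>f i * F - g i * G = f i * (F - G) + (f i - g i) * G\<close>.\<close>

lemma p_integral_prod_cong:
  fixes f g :: "'b \<Rightarrow> rat"
  assumes "prime p"
    and "\<And>i. i \<in> A \<Longrightarrow> p_integral p (f i)" "\<And>i. i \<in> A \<Longrightarrow> p_integral p (g i)"
    and "\<And>i. i \<in> A \<Longrightarrow> p_integral p ((f i - g i) / of_nat p)"
  shows "p_integral p ((prod f A - prod g A) / of_nat p)"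
  using assms(2-)
proof (induction A rule: infinite_finite_induct)
  case (insert i A)
  have "(prod f (insert i A) - prod g (insert i A)) / of_nat p =
      f i * ((prod f A - prod g A) / of_nat p) + (f i - g i) / of_nat p * prod g A"
    using insert.hyps by (simp add: diff_divide_distrib algebra_simps)
  moreover have "p_integral p \<dots>"
    by (intro p_integral_add p_integral_mult p_integral_prod assms(1) insert.IH insert.prems) auto
  ultimately show ?case by metis
qed (auto simp: p_integral_0 assms(1))

lemma p_integral_reflected_prod:
  assumes "prime p" "\<And>i. i \<in> A \<Longrightarrow> 0 < k i \<and> k i < p"
  shows "p_integral p
    ((1 / (\<Prod>i\<in>A. of_nat (p - k i)) - (-1) ^ card A * (1 / (\<Prod>i\<in>A. of_nat (k i)))) / of_nat p)"
proof -
  have inv: "p_integral p (1 / of_nat (k i))" "p_integral p (1 / of_nat (p - k i))" if "i \<in> A" for i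
    using assms(2)[OF that] by (intro p_integral_inverse_of_nat nat_dvd_not_less; simp)+
  have "p_integral p (((\<Prod>i\<in>A. 1 / of_nat (p - k i)) - (\<Prod>i\<in>A. - (1 / of_nat (k i)))) / of_nat p)"
  proof (rule p_integral_prod_cong)
    fix i assume i: "i \<in> A"
    \<comment> \<open>Since \<open>p - k i\<close> is congruent to \<open>- k i\<close>, so are the
      inverses; explicitly, 1/(p - k) + 1/k = p/(k (p - k)).\<close>
    have "(1 / of_nat (p - k i) - - (1 / of_nat (k i))) / of_nat p
        = (1 / of_nat (p - k i)) * (1 / of_nat (k i) :: rat)"
      using assms(2)[OF i] by (simp add: of_nat_diff field_simps)
    then show "p_integral p ((1 / of_nat (p - k i) - - (1 / of_nat (k i))) / of_nat p)"
      using inv[OF i] p_integral_mult assms(1) by metis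
  qed (use assms inv in \<open>auto intro: p_integral_uminus simp del: of_nat_diff\<close>)
  moreover have "(\<Prod>i\<in>A. - (1 / of_nat (k i))) = (-1) ^ card A * (1 / (\<Prod>i\<in>A. of_nat (k i) :: rat))"
    by (simp add: prod_uminus prod_dividef)
  moreover have "(\<Prod>i\<in>A. 1 / of_nat (p - k i)) = 1 / (\<Prod>i\<in>A. of_nat (p - k i) :: rat)"
    by (simp add: prod_dividef del: of_nat_diff)
  ultimately show ?thesis by metis
qed

section \<open>Increasing tuples\<close>

lemma incr_tuples_0: "incr_tuples 0 q = {\<lambda>_. undefined}"
  by (auto simp: incr_tuples_def strict_mono_on_def)

lemma incr_tuples_range: "k \<in> incr_tuples n q \<Longrightarrow> i \<in> {1..n} \<Longrightarrow> 0 < k i \<and> k i < q"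
  unfolding incr_tuples_def by fastforce

lemma incr_tuples_less:
  "k \<in> incr_tuples n q \<Longrightarrow> 1 \<le> i \<Longrightarrow> i < j \<Longrightarrow> j \<le> n \<Longrightarrow> k i < k j"
  unfolding incr_tuples_def by (auto simp: strict_mono_on_def)

lemma incr_tuplesI:
  assumes "\<And>i. 1 \<le> i \<Longrightarrow> i \<le> n \<Longrightarrow> 0 < k i \<and> k i < q"
    and "\<And>i j. 1 \<le> i \<Longrightarrow> i < j \<Longrightarrow> j \<le> n \<Longrightarrow> k i < k j"
    and "\<And>i. i \<notin> {1..n} \<Longrightarrow> k i = undefined"
  shows "k \<in> incr_tuples n q"
  unfolding incr_tuples_def using assms by (auto simp: strict_mono_on_def PiE_iff extensional_def)

lemma incr_tuples_undefined: "k \<in> incr_tuples n q \<Longrightarrow> i \<notin> {1..n} \<Longrightarrow> k i = undefined"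
  unfolding incr_tuples_def by (auto simp: PiE_iff extensional_def)

lemma finite_incr_tuples: "finite (incr_tuples n q)"
proof (rule finite_subset)
  show "incr_tuples n q \<subseteq> {1..n} \<rightarrow>\<^sub>E {0<..<q}" by (auto simp: incr_tuples_def)
qed (auto intro: finite_PiE)

text \<open>Tuples are sorted by their largest entry \<open>m\<close>; the other entries form an
  increasing tuple below \<open>m\<close>. Removing the last entry must reset position
  \<open>Suc n\<close> to \<open>undefined\<close> to keep the shorter tuple extensional.\<close>

lemma sum_incr_tuples_Suc:
  fixes f :: "(nat \<Rightarrow> nat) \<Rightarrow> 'b::comm_monoid_add"
  shows "(\<Sum>k\<in>incr_tuples (Suc n) q. f k) =
    (\<Sum>m\<in>{0<..<q}. \<Sum>k\<in>incr_tuples n m. f (k(Suc n := m)))"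
proof -
  have "(\<Sum>m\<in>{0<..<q}. \<Sum>k\<in>incr_tuples n m. f (k(Suc n := m))) =
      (\<Sum>(m, k)\<in>(SIGMA m:{0<..<q}. incr_tuples n m). f (k(Suc n := m)))"
    by (rule sum.Sigma) (auto simp: finite_incr_tuples)
  also have "\<dots> = (\<Sum>k\<in>incr_tuples (Suc n) q. f k)"
  proof (rule sum.reindex_bij_witness[where
        j = "\<lambda>(m, k). k(Suc n := m)" and i = "\<lambda>k. (k (Suc n), k(Suc n := undefined))"])
    fix k assume k: "k \<in> incr_tuples (Suc n) q"
    show "(k (Suc n), k(Suc n := undefined)) \<in> (SIGMA m:{0<..<q}. incr_tuples n m)"
      using incr_tuples_range[OF k] incr_tuples_less[OF k] incr_tuples_undefined[OF k]
      by (auto intro!: incr_tuplesI)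
  next
    fix mk assume "mk \<in> (SIGMA m:{0<..<q}. incr_tuples n m)"
    then obtain m k where mk: "mk = (m, k)" "0 < m" "m < q" "k \<in> incr_tuples n m" by auto
    note k = incr_tuples_range[OF mk(4)] incr_tuples_less[OF mk(4)] incr_tuples_undefined[OF mk(4)]
    have "k(Suc n := m) \<in> incr_tuples (Suc n) q"
    proof (rule incr_tuplesI)
      show "0 < (k(Suc n := m)) i \<and> (k(Suc n := m)) i < q" if "1 \<le> i" "i \<le> Suc n" for i
        using k(1)[of i] mk that by (cases "i = Suc n") auto
      show "(k(Suc n := m)) i < (k(Suc n := m)) j" if "1 \<le> i" "i < j" "j \<le> Suc n" for i j
        using k(1)[of i] k(2)[of i j] mk that by (cases "j = Suc n") auto
      show "(k(Suc n := m)) i = undefined" if "i \<notin> {1..Suc n}" for i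
        using k(3)[of i] that by auto
    qed
    then show "(case mk of (m, k) \<Rightarrow> k(Suc n := m)) \<in> incr_tuples (Suc n) q"
      using mk(1) by simp
    show "((case mk of (m, k) \<Rightarrow> k(Suc n := m)) (Suc n),
        (case mk of (m, k) \<Rightarrow> k(Suc n := m))(Suc n := undefined)) = mk"
      using mk(1) k(3)[of "Suc n"] by (simp add: fun_upd_idem)
  qed auto
  finally show ?thesis by simp
qed

text \<open>Complementing the entries reverses their order and reversing the positions restores it,
  so the map is an involution on the tuples.\<close>

lemma sum_incr_tuples_reflect:
  "(\<Sum>k\<in>incr_tuples n p. f k) =
    (\<Sum>k\<in>incr_tuples n p. f (\<lambda>i\<in>{1..n}. p - k (n + 1 - i)))"
proof -
  define rv where "rv k = (\<lambda>i\<in>{1..n}. p - k (n + 1 - i))" for k :: "nat \<Rightarrow> nat"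
  have mem: "rv k \<in> incr_tuples n p" if k: "k \<in> incr_tuples n p" for k
  proof (rule incr_tuplesI)
    have range: "0 < k (n + 1 - i) \<and> k (n + 1 - i) < p" if "1 \<le> i" "i \<le> n" for i
      using that by (intro incr_tuples_range[OF k]) auto
    show "0 < rv k i \<and> rv k i < p" if "1 \<le> i" "i \<le> n" for i
      using range[OF that] that by (simp add: rv_def)
    show "rv k i < rv k j" if "1 \<le> i" "i < j" "j \<le> n" for i j
    proof -
      have "k (n + 1 - j) < k (n + 1 - i)"
        using that by (intro incr_tuples_less[OF k]) auto
      then show ?thesis using range[of i] range[of j] that by (simp add: rv_def)
    qed
  qed (auto simp: rv_def)
  have invol: "rv (rv k) = k" if k: "k \<in> incr_tuples n p" for k
  proof
    fix i show "rv (rv k) i = k i"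
    proof (cases "i \<in> {1..n}")
      case True
      then have "n + 1 - i \<in> {1..n}" "n + 1 - (n + 1 - i) = i" by auto
      with True show ?thesis
        using incr_tuples_range[OF k True] by (simp add: rv_def)
    next
      case False
      then show ?thesis
        unfolding incr_tuples_undefined[OF k False] rv_def restrict_def by (simp only: if_False)
    qed
  qed
  have "(\<Sum>k\<in>incr_tuples n p. f (rv k)) = (\<Sum>k\<in>incr_tuples n p. f k)"
    by (rule sum.reindex_bij_witness[where i = rv and j = rv]) (auto simp: mem invol)
  then show ?thesis by (simp add: rv_def)
qed

section \<open>Binomial polynomials\<close>

text \<open>As a function of \<open>x\<close> this is \<open>(x + c + N - 1) gchoose N\<close>.\<close>

definition binom_poly :: "nat \<Rightarrow> nat \<Rightarrow> rat poly" where
  "binom_poly c N = smult (1 / fact N) (pochhammer [:of_nat c, 1:] N)"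

lemma poly_pochhammer: "poly (pochhammer q N) x = pochhammer (poly q x) N"
  by (induction N) (simp_all add: pochhammer_Suc)

lemma binom_poly_0: "binom_poly c 0 = 1"
  by (simp add: binom_poly_def)

text \<open>The new factor is (x + 1 + N)/(N + 1) = 1 + x/(N + 1), and \<open>pCons 0\<close>
  multiplies by x.\<close>

lemma binom_poly_1_Suc:
  "binom_poly 1 (Suc N) = binom_poly 1 N + smult (1 / of_nat (Suc N)) (pCons 0 (binom_poly 1 N))"
proof -
  have eq: "[:of_nat 1, 1:] + of_nat N = ([:of_nat (Suc N), 1:] :: rat poly)"
    by (simp add: of_nat_poly)
  show ?thesis
    unfolding binom_poly_def pochhammer_Suc eq
    by (simp add: field_simps smult_add_right del: of_nat_Suc)
qed

text \<open>For \<open>c = 0\<close> the first factor is x itself. Splitting it off yields the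
  factor 1/(N + 1) that later accounts for the extra 1/\<open>k n\<close> in the first part.\<close>

lemma binom_poly_0_Suc:
  "binom_poly 0 (Suc N) = smult (1 / of_nat (Suc N)) (pCons 0 (binom_poly 1 N))"
  unfolding binom_poly_def pochhammer_rec
  by (simp add: one_pCons field_simps)

text \<open>Both sides are the \<open>n\<close>-th elementary symmetric polynomial in 1, 1/2, ...,
  1/N, because \<open>binom_poly 1 N\<close> is the product of the factors 1 + x/i.\<close>

lemma sum_incr_tuples_inverse:
  "(\<Sum>k\<in>incr_tuples n (Suc N). 1 / (\<Prod>i=1..n. of_nat (k i))) = coeff (binom_poly 1 N) n"
proof (induction n arbitrary: N)
  case 0
  have "coeff (binom_poly 1 N) 0 = 1"
    by (induction N) (simp_all add: binom_poly_0 binom_poly_1_Suc del: One_nat_def)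
  then show ?case by (simp add: incr_tuples_0)
next
  case (Suc n)
  note outer = Suc
  have prod_upd: "(\<Prod>i=1..Suc n. of_nat ((k(Suc n := m)) i)) = (\<Prod>i=1..n. of_nat (k i)) * (of_nat m :: rat)"
    for k m by (simp add: prod.nat_ivl_Suc')
  have rec: "(\<Sum>k\<in>incr_tuples (Suc n) q. 1 / (\<Prod>i=1..Suc n. of_nat (k i))) =
    (\<Sum>m\<in>{0<..<q}. 1 / of_nat m * (\<Sum>k\<in>incr_tuples n m. 1 / (\<Prod>i=1..n. of_nat (k i) :: rat)))" for q
    unfolding sum_incr_tuples_Suc prod_upd sum_distrib_left by (simp add: mult.commute)
  \<comment> \<open>Inner induction on \<open>N\<close>: the new largest entry N + 1 contributes, by
    the outer hypothesis, the second summand of the recurrence for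
    \<open>binom_poly 1\<close>.\<close>
  show ?case unfolding rec
  proof (induction N)
    case 0
    have "{0<..<Suc 0} = {}" by auto
    then show ?case by (simp add: binom_poly_0)
  next
    case (Suc N)
    have "{0<..<Suc (Suc N)} = insert (Suc N) {0<..<Suc N}" by auto
    then show ?case
      using Suc by (simp add: binom_poly_1_Suc outer del: of_nat_Suc One_nat_def)
  qed
qed

text \<open>The denominator omits the largest entry so that both parts fit: in the first part
  \<open>f\<close> carries the missing factor 1/q.\<close>

lemma sum_incr_tuples_last:
  fixes f :: "nat \<Rightarrow> rat"
  shows "(\<Sum>k\<in>incr_tuples (Suc m) p. f (k (Suc m)) / (\<Prod>i=1..m. of_nat (k i))) =
    (\<Sum>q\<in>{0<..<p}. f q * coeff (binom_poly 1 (q - 1)) m)"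
  unfolding sum_incr_tuples_Suc
proof (intro sum.cong refl)
  fix q assume "q \<in> {0<..<p}"
  then have q: "Suc (q - 1) = q" by auto
  have "(\<Sum>k\<in>incr_tuples m q. f ((k(Suc m := q)) (Suc m)) / (\<Prod>i=1..m. of_nat ((k(Suc m := q)) i))) =
      (\<Sum>k\<in>incr_tuples m q. f q * (1 / (\<Prod>i=1..m. of_nat (k i))))"
    by simp
  also have "\<dots> = f q * coeff (binom_poly 1 (q - 1)) m"
    unfolding sum_distrib_left[symmetric] using sum_incr_tuples_inverse[of m "q - 1"] q by metis
  finally show "(\<Sum>k\<in>incr_tuples m q. f ((k(Suc m := q)) (Suc m)) / (\<Prod>i=1..m. of_nat ((k(Suc m := q)) i))) =
      f q * coeff (binom_poly 1 (q - 1)) m" .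
qed

text \<open>This is the substitution of -x for x.\<close>

lemma coeff_reflected_pochhammer:
  "coeff (pochhammer [:c, -1:] N) d = (-1) ^ d * coeff (pochhammer [:c, 1:] N) d"
  for c :: "'a::idom"
proof -
  have "pochhammer [:c, -1:] N = pcompose (pochhammer [:c, 1:] N) [:0, -1:]"
    unfolding pochhammer_prod pcompose_prod
    by (intro prod.cong) (auto simp: pcompose_pCons of_nat_poly)
  then show ?thesis by (simp add: coeff_pcompose_linear)
qed

text \<open>With y = x + c, this compares coefficients in (1 - t)^(-j-1) * (1 - t)^(-y) = (1 -
  t)^(-(y+j+1)).\<close>

lemma sum_choose_binom_poly:
  assumes "j \<le> M"
  shows "(\<Sum>k=j..M. smult (of_nat (k choose j)) (binom_poly c (M - k))) =
    smult (1 / fact (M - j)) (pochhammer [:of_nat (c + j + 1), 1:] (M - j))"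
proof -
  have "poly (\<Sum>k=j..M. smult (of_nat (k choose j)) (binom_poly c (M - k))) x =
      poly (smult (1 / fact (M - j)) (pochhammer [:of_nat (c + j + 1), 1:] (M - j))) x" for x
  proof -
    define y where "y = x + of_nat c"
    define N where "N = M - j"
    have neg: "pochhammer z m / fact m = (-1) ^ m * ((- z) gchoose m)" for z :: rat and m
      by (simp add: gbinomial_pochhammer pochhammer_minus[of "-z"])
    have ch: "of_nat ((j + l) choose j) = (-1) ^ l * ((- of_nat j - 1 :: rat) gchoose l)" for l
    proof -
      have "(of_nat ((j + l) choose j) :: rat) = of_nat ((j + l) choose l)"
        by (subst binomial_symmetric) auto
      also have "\<dots> = (-1) ^ l * ((of_nat l - of_nat (j + l) - 1) gchoose l)"
        unfolding binomial_gbinomial by (rule gbinomial_negated_upper)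
      finally show ?thesis by simp
    qed
    have "poly (\<Sum>k=j..M. smult (of_nat (k choose j)) (binom_poly c (M - k))) x =
        (\<Sum>k=j..M. of_nat (k choose j) * (pochhammer y (M - k) / fact (M - k)))"
      by (simp add: poly_sum binom_poly_def poly_pochhammer y_def add_ac)
    also have "\<dots> = (\<Sum>l\<le>N. of_nat ((j + l) choose j) * (pochhammer y (N - l) / fact (N - l)))"
      by (rule sum.reindex_bij_witness[where i = "\<lambda>l. j + l" and j = "\<lambda>k. k - j"])
        (use assms in \<open>auto simp: N_def\<close>)
    \<comment> \<open>Both factors are rewritten with negated upper argument; their signs combine to
      one independent of \<open>l\<close>, which leaves a Vandermonde sum.\<close>
    also have "\<dots> = (\<Sum>l\<le>N. (-1) ^ N * (((- of_nat j - 1) gchoose l) * ((- y) gchoose (N - l))))"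
    proof (rule sum.cong)
      fix l assume "l \<in> {..N}"
      then have "(-1 :: rat) ^ N = (-1) ^ l * (-1) ^ (N - l)"
        by (simp flip: power_add)
      then show "of_nat ((j + l) choose j) * (pochhammer y (N - l) / fact (N - l)) =
          (-1) ^ N * (((- of_nat j - 1) gchoose l) * ((- y) gchoose (N - l)))"
        unfolding ch neg by simp
    qed simp
    also have "\<dots> = (-1) ^ N * ((- (of_nat j + 1 + y)) gchoose N)"
      unfolding sum_distrib_left[symmetric] atMost_atLeast0 gbinomial_Vandermonde
      by (simp only: minus_add_distrib diff_conv_add_uminus)
    also have "\<dots> = pochhammer (of_nat j + 1 + y) N / fact N"
      by (rule neg[symmetric])
    finally show ?thesis
      by (simp add: poly_pochhammer N_def y_def add_ac)
  qed
  then show ?thesis by (simp add: poly_eq_poly_eq_iff[symmetric] fun_eq_iff)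
qed

section \<open>Pochhammer coefficients modulo \<open>p\<close> and the self-duality of the
  sum\<close>

lemma p_integral_coeff_pochhammer:
  "prime p \<Longrightarrow> p_integral p (coeff (pochhammer [:of_int s, 1:] N) d)"
proof (induction N arbitrary: d)
  case 0
  then show ?case by (cases d) (auto simp: p_integral_0 p_integral_1)
next
  case (Suc N)
  have "[:of_int s, 1:] + of_nat N = ([:of_int (s + int N), 1:] :: rat poly)"
    by (simp add: of_nat_poly)
  with Suc show ?case
    unfolding pochhammer_Suc
    by (cases d) (auto intro!: p_integral_add p_integral_mult p_integral_of_int simp del: of_int_add)
qed

lemma p_integral_coeff_pochhammer_shift:
  assumes "prime p"
  shows "p_integral p ((coeff (pochhammer [:of_int (s + int p), 1:] N) d
    - coeff (pochhammer [:of_int s, 1:] N) d) / of_nat p)"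
proof (induction N arbitrary: d)
  case 0
  then show ?case by (simp add: p_integral_0 assms)
next
  case (Suc N)
  define P Q :: "rat poly" where "P = pochhammer [:of_int (s + int p), 1:] N"
    and "Q = pochhammer [:of_int s, 1:] N"
  define u where "u = s + int N"
  have eqs: "[:of_int s, 1:] + of_nat N = ([:of_int u, 1:] :: rat poly)"
    "[:of_int (s + int p), 1:] + of_nat N = ([:of_int u + of_nat p, 1:] :: rat poly)"
    by (simp_all add: of_nat_poly u_def)
  have IH: "p_integral p ((coeff P d - coeff Q d) / of_nat p)" for d
    using Suc unfolding P_def Q_def .
  have int: "p_integral p (coeff P d)" for d
    unfolding P_def by (rule p_integral_coeff_pochhammer[OF assms])
  have p0: "(of_nat p :: rat) \<noteq> 0" using assms by (simp add: prime_gt_0_nat)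
  \<comment> \<open>The difference of the products is u (P - Q) + p P + x (P - Q); the last term
    shifts the degree by one, hence the case distinction on \<open>d\<close>.\<close>
  have "(coeff (P * [:of_int u + of_nat p, 1:]) d - coeff (Q * [:of_int u, 1:]) d) / of_nat p =
      of_int u * ((coeff P d - coeff Q d) / of_nat p) + coeff P d +
      (case d of 0 \<Rightarrow> 0 | Suc e \<Rightarrow> (coeff P e - coeff Q e) / of_nat p)"
    using p0 by (cases d) (simp_all add: field_simps)
  moreover have "p_integral p (case d of 0 \<Rightarrow> 0 | Suc e \<Rightarrow> (coeff P e - coeff Q e) / of_nat p)"
    using IH by (cases d) (auto simp: p_integral_0 assms)
  ultimately show ?case
    unfolding pochhammer_Suc eqs P_def[symmetric] Q_def[symmetric]
    by (simp only:) (intro p_integral_add p_integral_mult p_integral_of_int IH int assms)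
qed

text \<open>With N = M - j, the hypothesis on \<open>p\<close> gives c + j + 1 = s + p for s = 1 - c
  - N. Modulo \<open>p\<close> the factors are thus x + s, ..., x - c; negated and read backwards
  they are c - x, ..., c - x + N - 1, those of \<open>binom_poly c N\<close> at -x. Negation gives
  the sign (-1)^N, reflection gives (-1)^d, and N < p makes N! invertible modulo
  \<open>p\<close>.\<close>

lemma p_integral_binom_poly_dual:
  assumes "prime p" "M + 2 * c = p" "j \<le> M" "M - j < p"
  shows "p_integral p ((coeff (\<Sum>k=j..M. smult (of_nat (k choose j)) (binom_poly c (M - k))) d
    - (-1) ^ (M - j + d) * coeff (binom_poly c (M - j)) d) / of_nat p)"
proof -
  define N where "N = M - j"
  define s where "s = 1 - int c - int N"
  have "pochhammer [:of_nat c, -1:] N = (-1) ^ N * pochhammer ([:- of_nat c, 1:] - of_nat N + 1 :: rat poly) N"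
    using pochhammer_minus[of "[:- of_nat c, 1:] :: rat poly" N] by simp
  also have "[:- of_nat c, 1:] - of_nat N + 1 = ([:of_int s, 1:] :: rat poly)"
    by (simp add: of_nat_poly one_pCons s_def)
  finally have "coeff (pochhammer [:of_nat c, -1:] N) d
      = (-1) ^ N * coeff (pochhammer [:of_int s, 1:] N :: rat poly) d"
    by (cases "even N") simp_all
  then have refl: "coeff (pochhammer [:of_int s, 1:] N :: rat poly) d =
      (-1) ^ (N + d) * coeff (pochhammer [:of_nat c, 1:] N) d"
    unfolding coeff_reflected_pochhammer by (cases "even N"; cases "even d") simp_all
  have s: "of_nat (c + j + 1) = (of_int (s + int p) :: rat)"
    using assms(2,3) by (simp add: s_def N_def of_nat_diff)
  have "\<not> p dvd fact N"
    using assms(1,4) by (simp add: prime_dvd_fact_iff N_def)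
  then have fact: "p_integral p (1 / fact N)"
    using p_integral_inverse_of_nat[of p "fact N"] by simp
  have "(coeff (\<Sum>k=j..M. smult (of_nat (k choose j)) (binom_poly c (M - k))) d
      - (-1) ^ (N + d) * coeff (binom_poly c N) d) / of_nat p =
    1 / fact N * ((coeff (pochhammer [:of_int (s + int p), 1:] N) d
      - coeff (pochhammer [:of_int s, 1:] N) d) / of_nat p)"
    unfolding sum_choose_binom_poly[OF assms(3)] s N_def[symmetric] refl
    by (simp add: binom_poly_def diff_divide_distrib algebra_simps)
  then show ?thesis
    using p_integral_mult[OF assms(1) fact p_integral_coeff_pochhammer_shift[OF assms(1)]]
    unfolding N_def by metis
qed

text \<open>For \<open>M = p\<close> the term \<open>a p\<close> may fail to be \<open>p\<close>-integral, but its coefficients in the two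
  sums being compared are equal, not merely congruent.\<close>

lemma p_integral_sum_binom_poly:
  fixes a :: "nat \<Rightarrow> rat"
  assumes p: "prime p" "odd p" and M: "M + 2 * c = p"
    and transform: "\<And>r. a r = e * binomial_transform a r"
    and e: "e * (-1) ^ (M + d) = -1" "p_integral p e"
    and a: "\<And>j. j < M \<Longrightarrow> a j = 0 \<or> M - j < p \<and> p_integral p (a j)"
  shows "p_integral p ((\<Sum>k\<le>M. a k * coeff (binom_poly c (M - k)) d) / of_nat p)"
proof -
  define T where "T = (\<Sum>k\<le>M. a k * coeff (binom_poly c (M - k)) d)"
  \<comment> \<open>Up to the factor \<open>e * (-1) ^ j\<close>, this is what multiplies
    \<open>a j\<close> after the transform is inserted and the sums are exchanged.\<close>
  define H where "H j = coeff (\<Sum>k=j..M. smult (of_nat (k choose j)) (binom_poly c (M - k))) d" for j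
  have "T = (\<Sum>k\<le>M. \<Sum>j\<le>k. e * (-1) ^ j * a j * (of_nat (k choose j) * coeff (binom_poly c (M - k)) d))"
    unfolding T_def
    by (subst transform, unfold binomial_transform_def)
      (simp add: sum_distrib_left sum_distrib_right atLeast0AtMost mult_ac)
  also have "\<dots> = (\<Sum>j\<le>M. \<Sum>k=j..M. e * (-1) ^ j * a j * (of_nat (k choose j) * coeff (binom_poly c (M - k)) d))"
    by (subst sum.Sigma, simp, simp, subst sum.Sigma, simp, simp)
      (rule sum.reindex_bij_witness[where i = prod.swap and j = prod.swap], auto)
  also have "\<dots> = (\<Sum>j\<le>M. e * (-1) ^ j * a j * H j)"
    unfolding H_def by (simp add: coeff_sum sum_distrib_left)
  finally have T: "T = (\<Sum>j\<le>M. e * (-1) ^ j * a j * H j)" .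
  \<comment> \<open>Replacing each \<open>H j\<close> by its dual value gives exactly
    \<open>- T\<close>, since the signs multiply to \<open>e * (-1) ^ (M + d) = -1\<close> for every
    \<open>j\<close>.\<close>
  have minus_T: "- T = (\<Sum>j\<le>M. e * (-1) ^ j * a j * ((-1) ^ (M - j + d) * coeff (binom_poly c (M - j)) d))"
  proof -
    have "(-1 :: rat) ^ j * (-1) ^ (M - j + d) = (-1) ^ (M + d)" if "j \<le> M" for j
      using that by (simp flip: power_add)
    then have sign: "e * (-1) ^ j * (-1) ^ (M - j + d) = - 1" if "j \<le> M" for j
      using e(1) that by (metis mult.assoc)
    have "e * (-1) ^ j * a j * ((-1) ^ (M - j + d) * coeff (binom_poly c (M - j)) d)
        = - (a j * coeff (binom_poly c (M - j)) d)" if "j \<le> M" for j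
    proof -
      have "e * (-1) ^ j * a j * ((-1) ^ (M - j + d) * coeff (binom_poly c (M - j)) d) =
          (e * (-1) ^ j * (-1) ^ (M - j + d)) * (a j * coeff (binom_poly c (M - j)) d)"
        by (simp only: mult_ac)
      with sign[OF that] show ?thesis by simp
    qed
    then show ?thesis unfolding T_def sum_negf[symmetric] by (intro sum.cong) auto
  qed
  have "(T - - T) / of_nat p = (\<Sum>j\<le>M. e * (-1) ^ j * a j *
      ((H j - (-1) ^ (M - j + d) * coeff (binom_poly c (M - j)) d) / of_nat p))"
    unfolding minus_T unfolding T sum_subtractf[symmetric] sum_divide_distrib
    by (intro sum.cong) (simp_all add: algebra_simps diff_divide_distrib)
  also have "p_integral p \<dots>"
  proof (rule p_integral_sum[OF p(1)])
    fix j assume "j \<in> {..M}"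
    then consider "j = M" | "j < M" "a j = 0" | "j < M" "M - j < p" "p_integral p (a j)"
      using a[of j] by force
    then show "p_integral p (e * (-1) ^ j * a j *
      ((H j - (-1) ^ (M - j + d) * coeff (binom_poly c (M - j)) d) / of_nat p))"
    proof cases
      \<comment> \<open>Both terms are coefficients of the polynomial 1, which vanish unless
        \<open>d = 0\<close>, where the sign is 1.\<close>
      case 1
      then have "H j - (-1) ^ (M - j + d) * coeff (binom_poly c (M - j)) d = 0"
        by (cases d) (simp_all add: H_def binom_poly_0)
      then show ?thesis by (simp add: p_integral_0 p)
    next
      \<comment> \<open>In the first part this is \<open>j = 0\<close>, where
        \<open>M - j = p\<close> and the factorial is divisible by \<open>p\<close>.\<close>
      case 2
      then show ?thesis by (simp add: p_integral_0 p)
    next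
      case 3
      have "p_integral p ((-1) ^ j)"
        using p_integral_of_int[OF p(1), of "(-1) ^ j"] by simp
      then show ?thesis
        using 3 p e(2) p_integral_binom_poly_dual[OF p(1) M, of j d]
        unfolding H_def by (intro p_integral_mult) auto
    qed
  qed
  finally have "p_integral p ((T - - T) / of_nat p)" .
  \<comment> \<open>The difference just treated is 2 T, and 2 is invertible modulo the odd prime
    \<open>p\<close>.\<close>
  moreover have "p_integral p (1 / of_nat 2)"
    using p primes_dvd_imp_eq[of p 2] by (intro p_integral_inverse_of_nat) auto
  ultimately have "p_integral p (1 / of_nat 2 * ((T - - T) / of_nat p))"
    using p_integral_mult p(1) by blast
  then show ?thesis unfolding T_def[symmetric] by simp
qed

section \<open>From sums governed by the largest entry to sums governed by the smallest\<close>

lemma rat_cong_0_if_reflected: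
  assumes p: "prime p" and T: "p_integral p (T / of_nat p)"
    and S: "p_integral p ((S - (-1) ^ c * T) / of_nat p)"
  shows "rat_cong p T S \<and> rat_cong p S 0"
proof -
  \<comment> \<open>As T vanishes modulo \<open>p\<close>, the sign relating S to T does not affect
    the conclusion.\<close>
  have "S / of_nat p = (S - (-1) ^ c * T) / of_nat p + of_int ((-1) ^ c) * (T / of_nat p)"
    by (simp add: diff_divide_distrib)
  then have S': "p_integral p (S / of_nat p)"
    using p T S p_integral_add p_integral_mult p_integral_of_int by metis
  moreover have "p_integral p ((T - S) / of_nat p)"
    using p_integral_diff[OF p T S'] by (simp add: diff_divide_distrib)
  ultimately show ?thesis
    unfolding rat_cong_def
    using p_integral_if_divisible[OF p T] p_integral_if_divisible[OF p S'] p_integral_0[OF p] by simp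
qed

text \<open>Reflection turns \<open>k 1\<close> into \<open>p - k n\<close> exactly; only the
  denominators change modulo \<open>p\<close>, with one sign for each position in \<open>I\<close>.
  The set \<open>I\<close> is kept general to cover the denominators of both parts.\<close>

lemma p_integral_sum_incr_tuples_reflect:
  fixes f :: "nat \<Rightarrow> rat"
  assumes p: "prime p" and n: "n > 0" and I: "I \<subseteq> {1..n}"
    and f: "\<And>m. 0 < m \<Longrightarrow> m < p \<Longrightarrow> p_integral p (f m)"
  shows "p_integral p
    (((\<Sum>k\<in>incr_tuples n p. f (k 1) / (\<Prod>i\<in>(\<lambda>i. n + 1 - i) ` I. of_nat (k i)))
      - (-1) ^ card I * (\<Sum>k\<in>incr_tuples n p. f (p - k n) / (\<Prod>i\<in>I. of_nat (k i)))) / of_nat p)"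
proof -
  have inj: "inj_on (\<lambda>i. n + 1 - i) I"
    using I by (intro inj_onI) fastforce
  have prod_eq: "(\<Prod>i\<in>(\<lambda>i. n + 1 - i) ` I. of_nat ((\<lambda>i\<in>{1..n}. p - k (n + 1 - i)) i)) =
      (\<Prod>i\<in>I. of_nat (p - k i) :: rat)" for k :: "nat \<Rightarrow> nat"
    unfolding prod.reindex[OF inj] o_def
  proof (rule prod.cong)
    fix i assume "i \<in> I"
    with I have "1 \<le> i" "i \<le> n" by auto
    then have "n + 1 - i \<in> {1..n}" "n + 1 - (n + 1 - i) = i" by auto
    then show "of_nat ((\<lambda>i\<in>{1..n}. p - k (n + 1 - i)) (n + 1 - i)) = (of_nat (p - k i) :: rat)"
      by (simp only: restrict_apply if_True)
  qed simp
  have first: "(\<lambda>i\<in>{1..n}. p - k (n + 1 - i)) 1 = p - k n" for k :: "nat \<Rightarrow> nat"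
    using n by simp
  have reflected: "(\<Sum>k\<in>incr_tuples n p. f (k 1) / (\<Prod>i\<in>(\<lambda>i. n + 1 - i) ` I. of_nat (k i))) =
      (\<Sum>k\<in>incr_tuples n p. f (p - k n) / (\<Prod>i\<in>I. of_nat (p - k i)))"
    by (subst sum_incr_tuples_reflect) (simp only: first prod_eq)
  have "((\<Sum>k\<in>incr_tuples n p. f (k 1) / (\<Prod>i\<in>(\<lambda>i. n + 1 - i) ` I. of_nat (k i)))
      - (-1) ^ card I * (\<Sum>k\<in>incr_tuples n p. f (p - k n) / (\<Prod>i\<in>I. of_nat (k i)))) / of_nat p =
    (\<Sum>k\<in>incr_tuples n p. f (p - k n) *
      ((1 / (\<Prod>i\<in>I. of_nat (p - k i)) - (-1) ^ card I * (1 / (\<Prod>i\<in>I. of_nat (k i)))) / of_nat p))"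
    unfolding reflected sum_distrib_left sum_subtractf[symmetric] sum_divide_distrib
    by (simp add: diff_divide_distrib right_diff_distrib mult_ac del: of_nat_diff)
  also have "p_integral p \<dots>"
  proof (intro p_integral_sum p_integral_mult p_integral_reflected_prod p)
    fix k assume k: "k \<in> incr_tuples n p"
    show "p_integral p (f (p - k n))"
      using incr_tuples_range[OF k, of n] n by (intro f) auto
    show "0 < k i \<and> k i < p" if "i \<in> I" for i
      using incr_tuples_range[OF k, of i] I that by blast
  qed
  finally show ?thesis .
qed

lemma image_reflect:
  fixes m n :: nat
  assumes "m \<le> n"
  shows "(\<lambda>i. n + 1 - i) ` {1..m} = {n + 1 - m..n}"
proof
  show "{n + 1 - m..n} \<subseteq> (\<lambda>i. n + 1 - i) ` {1..m}"
  proof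
    fix i assume "i \<in> {n + 1 - m..n}"
    with assms have "i = n + 1 - (n + 1 - i)" "n + 1 - i \<in> {1..m}" by auto
    then show "i \<in> (\<lambda>i. n + 1 - i) ` {1..m}" by (rule image_eqI)
  qed
qed (use assms in auto)

section \<open>The congruences for \<open>S_minus\<close> and \<open>S_plus\<close>\<close>

theorem corollary1p2:
  fixes n p :: nat
  assumes "n > 0" and "odd n" and "prime p" and "p > n + 1"
  shows
    "(\<forall>a :: nat \<Rightarrow> rat. a \<in> S_minus \<longrightarrow> (\<forall>j\<in>{0..p-1}. p_integral p (a j)) \<longrightarrow>
        rat_cong p
          (\<Sum>k\<in>incr_tuples n p. a (p - k n) / (\<Prod>i=1..n. of_nat (k i)))
          (\<Sum>k\<in>incr_tuples n p. a (k 1) / (\<Prod>i=1..n. of_nat (k i))) \<and>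
        rat_cong p
          (\<Sum>k\<in>incr_tuples n p. a (k 1) / (\<Prod>i=1..n. of_nat (k i)))
          0) \<and>
     (\<forall>a :: nat \<Rightarrow> rat. a \<in> S_plus \<longrightarrow> (\<forall>j\<in>{0..p-2}. p_integral p (a j)) \<longrightarrow>
        rat_cong p
          (\<Sum>k\<in>incr_tuples n p. a (p - k n - 1) / (\<Prod>i=1..n-1. of_nat (k i)))
          (\<Sum>k\<in>incr_tuples n p. a (k 1 - 1) / (\<Prod>i=2..n. of_nat (k i))) \<and>
        rat_cong p
          (\<Sum>k\<in>incr_tuples n p. a (k 1 - 1) / (\<Prod>i=2..n. of_nat (k i)))
          0)"
proof -
  obtain m where n: "n = Suc m" using \<open>n > 0\<close> gr0_implies_Suc by blast
  have p: "prime p" "odd p" "p > 2"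
    using assms prime_odd_nat by auto
  have one: "p_integral p 1" "p_integral p (- 1)"
    using p_integral_1[OF p(1)] p_integral_uminus[OF p(1)] by auto
  have minus: "rat_cong p
          (\<Sum>k\<in>incr_tuples n p. a (p - k n) / (\<Prod>i=1..n. of_nat (k i)))
          (\<Sum>k\<in>incr_tuples n p. a (k 1) / (\<Prod>i=1..n. of_nat (k i))) \<and>
        rat_cong p
          (\<Sum>k\<in>incr_tuples n p. a (k 1) / (\<Prod>i=1..n. of_nat (k i)))
          0"
    if a: "a \<in> S_minus" and int: "\<forall>j\<in>{0..p-1}. p_integral p (a j)" for a :: "nat \<Rightarrow> rat"
  proof (rule rat_cong_0_if_reflected[OF p(1)])
    have trans: "a r = - 1 * binomial_transform a r" for r
      using a by (simp add: S_minus_def)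
    \<comment> \<open>At r = 0 the eigenvalue equation reads a 0 = - a 0.\<close>
    have a0: "a 0 = 0"
      using trans[of 0] by (simp add: binomial_transform_def)
    have "(\<Sum>k\<in>incr_tuples n p. a (p - k n) / (\<Prod>i=1..n. of_nat (k i))) =
        (\<Sum>k\<in>incr_tuples (Suc m) p. a (p - k (Suc m)) / of_nat (k (Suc m)) / (\<Prod>i=1..m. of_nat (k i)))"
      unfolding n by (simp add: prod.nat_ivl_Suc' mult_ac)
    also have "\<dots> = (\<Sum>q\<in>{0<..<p}. a (p - q) / of_nat q * coeff (binom_poly 1 (q - 1)) m)"
      by (rule sum_incr_tuples_last)
    \<comment> \<open>The factor 1/q is absorbed by passing to \<open>c = 0\<close>, which raises
      the degree from \<open>m\<close> to \<open>n\<close>.\<close>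
    also have "\<dots> = (\<Sum>q\<in>{0<..<p}. a (p - q) * coeff (binom_poly 0 q) n)"
    proof (rule sum.cong)
      fix q assume "q \<in> {0<..<p}"
      then have "binom_poly 0 q = binom_poly 0 (Suc (q - 1))" "Suc (q - 1) = q" by auto
      then show "a (p - q) / of_nat q * coeff (binom_poly 1 (q - 1)) m = a (p - q) * coeff (binom_poly 0 q) n"
        unfolding binom_poly_0_Suc by (simp add: n)
    qed simp
    also have "\<dots> = (\<Sum>k\<in>{0<..<p}. a k * coeff (binom_poly 0 (p - k)) n)"
      by (rule sum.reindex_bij_witness[where i = "\<lambda>k. p - k" and j = "\<lambda>k. p - k"]) auto
    \<comment> \<open>The added end terms vanish: k = 0 by \<open>a0\<close>, and k = p because the
      polynomial 1 has no term of degree n > 0.\<close>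
    also have "\<dots> = (\<Sum>k\<le>p. a k * coeff (binom_poly 0 (p - k)) n)"
    proof (rule sum.mono_neutral_left)
      show "\<forall>k\<in>{..p} - {0<..<p}. a k * coeff (binom_poly 0 (p - k)) n = 0"
      proof
        fix k assume "k \<in> {..p} - {0<..<p}"
        then have "k = 0 \<or> k = p" by auto
        then show "a k * coeff (binom_poly 0 (p - k)) n = 0"
          using a0 by (auto simp: binom_poly_0 n)
      qed
    qed auto
    finally have T: "(\<Sum>k\<in>incr_tuples n p. a (p - k n) / (\<Prod>i=1..n. of_nat (k i))) =
      (\<Sum>k\<le>p. a k * coeff (binom_poly 0 (p - k)) n)" .
    \<comment> \<open>Here M = p and d = n are both odd, so the sign condition holds with
      \<open>e = -1\<close>.\<close>
    show "p_integral p ((\<Sum>k\<in>incr_tuples n p. a (p - k n) / (\<Prod>i=1..n. of_nat (k i))) / of_nat p)"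
      unfolding T
    proof (rule p_integral_sum_binom_poly[where e = "- 1", OF p(1,2) _ trans])
      show "a j = 0 \<or> p - j < p \<and> p_integral p (a j)" if "j < p" for j
        using a0 int that by (cases "j = 0") auto
    qed (use p \<open>odd n\<close> one in auto)
    have img: "(\<lambda>i. n + 1 - i) ` {1..n} = {1..n}"
      using image_reflect[of n n] by simp
    show "p_integral p (((\<Sum>k\<in>incr_tuples n p. a (k 1) / (\<Prod>i=1..n. of_nat (k i))) -
      (-1) ^ card {1..n} * (\<Sum>k\<in>incr_tuples n p. a (p - k n) / (\<Prod>i=1..n. of_nat (k i)))) / of_nat p)"
      using p_integral_sum_incr_tuples_reflect[OF p(1) \<open>n > 0\<close> order.refl, of a] int
      unfolding img by auto
  qed
  have plus: "rat_cong p
          (\<Sum>k\<in>incr_tuples n p. a (p - k n - 1) / (\<Prod>i=1..n-1. of_nat (k i)))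
          (\<Sum>k\<in>incr_tuples n p. a (k 1 - 1) / (\<Prod>i=2..n. of_nat (k i))) \<and>
        rat_cong p
          (\<Sum>k\<in>incr_tuples n p. a (k 1 - 1) / (\<Prod>i=2..n. of_nat (k i)))
          0"
    if a: "a \<in> S_plus" and int: "\<forall>j\<in>{0..p-2}. p_integral p (a j)" for a :: "nat \<Rightarrow> rat"
  proof (rule rat_cong_0_if_reflected[OF p(1)])
    have trans: "a r = 1 * binomial_transform a r" for r
      using a by (simp add: S_plus_def)
    have "(\<Sum>k\<in>incr_tuples n p. a (p - k n - 1) / (\<Prod>i=1..n-1. of_nat (k i))) =
        (\<Sum>q\<in>{0<..<p}. a (p - q - 1) * coeff (binom_poly 1 (q - 1)) m)"
      using sum_incr_tuples_last[of "\<lambda>q. a (p - q - 1)" m p] by (simp add: n)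
    \<comment> \<open>Setting k = p - 1 - q gives exactly the range 0, ..., p - 2, so no end terms
      need adding.\<close>
    also have "\<dots> = (\<Sum>k\<le>p - 2. a k * coeff (binom_poly 1 (p - 2 - k)) m)"
    proof (rule sum.reindex_bij_witness[where i = "\<lambda>k. p - k - 1" and j = "\<lambda>k. p - k - 1"])
      fix q assume "q \<in> {0<..<p}"
      then have "p - 2 - (p - q - 1) = q - 1" by auto
      then show "a (p - q - 1) * coeff (binom_poly 1 (p - 2 - (p - q - 1))) m =
          a (p - q - 1) * coeff (binom_poly 1 (q - 1)) m"
        by (simp only:)
    qed (use p(3) in auto)
    finally have T: "(\<Sum>k\<in>incr_tuples n p. a (p - k n - 1) / (\<Prod>i=1..n-1. of_nat (k i))) =
      (\<Sum>k\<le>p - 2. a k * coeff (binom_poly 1 (p - 2 - k)) m)" .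
    show "p_integral p ((\<Sum>k\<in>incr_tuples n p. a (p - k n - 1) / (\<Prod>i=1..n-1. of_nat (k i))) / of_nat p)"
      unfolding T
    proof (rule p_integral_sum_binom_poly[where e = 1, OF p(1,2) _ trans])
      show "a j = 0 \<or> p - 2 - j < p \<and> p_integral p (a j)" if "j < p - 2" for j
        using int that p(3) by auto
      \<comment> \<open>Now p - 2 is odd and m = n - 1 is even.\<close>
      show "1 * (- 1) ^ (p - 2 + m) = (- 1 :: rat)"
        using p \<open>odd n\<close> n by simp
    qed (use p one in auto)
    \<comment> \<open>Omitting the last position from the denominator becomes, after reflection,
      omitting the first.\<close>
    have img: "(\<lambda>i. n + 1 - i) ` {1..n - 1} = {2..n}"
      using image_reflect[of "n - 1" n] \<open>n > 0\<close> by (simp add: numeral_2_eq_2)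
    show "p_integral p (((\<Sum>k\<in>incr_tuples n p. a (k 1 - 1) / (\<Prod>i=2..n. of_nat (k i))) -
      (-1) ^ card {1..n - 1} * (\<Sum>k\<in>incr_tuples n p. a (p - k n - 1) / (\<Prod>i=1..n-1. of_nat (k i)))) / of_nat p)"
      using p_integral_sum_incr_tuples_reflect[OF p(1) \<open>n > 0\<close>, of "{1..n - 1}" "\<lambda>m. a (m - 1)"] int
      unfolding img by auto
  qed
  show ?thesis using minus plus by blast
qed

end
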